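(* Let $(d_n)_{n\in\mathbb N_0}$ be a sequence of numbers $d_n\in\mathbb N_0$. The following conditions are equivalent: (1) $(d_n)_{n\in\mathbb N_0}$ is the dimension sequence of a subproduct system over $\mathbb N_0$, that is, there is a subproduct system $(H_n)_{n\in\mathbb N_0}$ with $\dim H_n=d_n$ for all $n\in\mathbb N_0$; (2) $(d_n)_{n\in\mathbb N_0}$ is the cardinality sequence of a word system, that is, there are an alphabet $A$ and a word system $(X_n)_{n\in\mathbb N_0}$ over $A$ with $\#X_n=d_n$ for all $n\in\mathbb N_0$.
   Context: $\mathbb N_0=\{0,1,2,\dots\}$. A subproduct system over $\mathbb N_0$ is a family $(H_n)_{n\in\mathbb N_0}$ of complex Hilbert spaces with $H_0=\mathbb C$, together with coisometries $w_{m,n}\colon H_m\otimes H_n\to H_{m+n}$ ($m,n\in\mathbb N_0$) such that the product $x_m y_n:=w_{m,n}(x_m\otimes y_n)$ is associative and such that $w_{0,n}\colon \mathbb C\otimes H_n\to H_n$ and $w_{n,0}\colon H_n\otimes\mathbb C\to H_n$ are the canonical identifications. An alphabet is a set $A$. $A^n$ is the set of words of length $n$ over $A$ ($n$-tuples of elements of $A$), $A^0=\{\Lambda\}$ with $\Lambda=()$ the empty word, and $A^*=\bigcup_{n\in\mathbb N_0}A^n$ is a monoid under concatenation. A word $y$ is a subword of $w$ if $w=xyz$ for some $x,z\in A^*$. A word system over $A$ is a family $(X_n)_{n\in\mathbb N_0}$ of subsets $X_n\subset A^n$ with $X_0=A^0$ that is closed under building subwords: whenever $w\in\bigcup_n X_n$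 and $y\in A^k$ is a subword of $w$, then $y\in X_k$. *)

theory Defs
  imports
    "HOL-Analysis.Analysis"
    "HOL-Library.Sublist"
    "HOL-Library.Equipollence"
    "Jordan_Normal_Form.VS_Connect"
begin

text \<open>Complex Hilbert spaces are carrier-based, so that the members of a family
  \<open>(H\<^sub>n)\<close> may be genuinely different spaces. The fields \<open>mult\<close> and \<open>one\<close> inherited
  from the ring record are not used. The inner product is antilinear in its first argument.\<close>

record 'h hilbert = "(complex, 'h) module" +
  ip :: "'h \<Rightarrow> 'h \<Rightarrow> complex"

definition hnorm :: "'h hilbert \<Rightarrow> 'h \<Rightarrow> real" where
  "hnorm H x = sqrt (Re (ip H x x))"

text \<open>\<open>Metric_space\<close> requires non-negativity and symmetry of the distance function also
  outside the carrier, hence the case distinction.\<close>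

definition hdist :: "'h hilbert \<Rightarrow> 'h \<Rightarrow> 'h \<Rightarrow> real" where
  "hdist H x y = (if x \<in> carrier H \<and> y \<in> carrier H then hnorm H (x \<ominus>\<^bsub>H\<^esub> y) else 0)"

locale hilbert_space = vectorspace "class_ring :: complex ring" H
  for H :: "'h hilbert" (structure) +
  assumes ip_add_right: "\<lbrakk>x \<in> carrier H; y \<in> carrier H; z \<in> carrier H\<rbrakk>
      \<Longrightarrow> ip H x (y \<oplus> z) = ip H x y + ip H x z"
    and ip_smult_right: "\<lbrakk>x \<in> carrier H; y \<in> carrier H\<rbrakk> \<Longrightarrow> ip H x (c \<odot> y) = c * ip H x y"
    and ip_commute: "\<lbrakk>x \<in> carrier H; y \<in> carrier H\<rbrakk> \<Longrightarrow> ip H y x = cnj (ip H x y)"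
    and ip_nonneg: "x \<in> carrier H \<Longrightarrow> 0 \<le> Re (ip H x x)"
    and ip_definite: "\<lbrakk>x \<in> carrier H; ip H x x = 0\<rbrakk> \<Longrightarrow> x = \<zero>"
    and complete: "Metric_space.mcomplete (carrier H) (hdist H)"

definition complex_hilbert :: "complex hilbert" where
  "complex_hilbert = \<lparr>carrier = UNIV, mult = (*), one = 1, zero = 0, add = (+),
     smult = (*), ip = (\<lambda>x y. cnj x * y)\<rparr>"

definition bounded_operator :: "'h hilbert \<Rightarrow> 'k hilbert \<Rightarrow> ('h \<Rightarrow> 'k) \<Rightarrow> bool" where
  "bounded_operator H K T \<longleftrightarrow>
     hilbert_space H \<and> hilbert_space K \<and> linear_map class_ring H K T \<and>
     (\<exists>C. \<forall>x \<in> carrier H. hnorm K (T x) \<le> C * hnorm H x)"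

definition is_adjoint_of :: "'h hilbert \<Rightarrow> 'k hilbert \<Rightarrow> ('h \<Rightarrow> 'k) \<Rightarrow> ('k \<Rightarrow> 'h) \<Rightarrow> bool" where
  "is_adjoint_of H K T S \<longleftrightarrow> bounded_operator K H S \<and>
     (\<forall>x \<in> carrier H. \<forall>y \<in> carrier K. ip H x (S y) = ip K (T x) y)"

definition coisometry :: "'h hilbert \<Rightarrow> 'k hilbert \<Rightarrow> ('h \<Rightarrow> 'k) \<Rightarrow> bool" where
  "coisometry H K T \<longleftrightarrow> bounded_operator H K T \<and>
     (\<exists>S. is_adjoint_of H K T S \<and> (\<forall>y \<in> carrier K. T (S y) = y))"

definition unitary_operator :: "'h hilbert \<Rightarrow> 'k hilbert \<Rightarrow> ('h \<Rightarrow> 'k) \<Rightarrow> bool" where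
  "unitary_operator H K U \<longleftrightarrow>
     hilbert_space H \<and> hilbert_space K \<and> linear_map class_ring H K U \<and>
     bij_betw U (carrier H) (carrier K) \<and>
     (\<forall>x \<in> carrier H. \<forall>y \<in> carrier H. ip K (U x) (U y) = ip H x y)"

text \<open>\<open>(T, t)\<close> is a Hilbert space tensor product of \<open>H\<close> and \<open>K\<close>, where \<open>t x y\<close> is the
  elementary tensor of \<open>x\<close> and \<open>y\<close>: a completion of the algebraic tensor product with respect
  to the inner product that is multiplicative on elementary tensors. These conditions determine
  \<open>(T, t)\<close> up to a unique unitary.\<close>

definition tensor_product ::
    "'h hilbert \<Rightarrow> 'k hilbert \<Rightarrow> 't hilbert \<Rightarrow> ('h \<Rightarrow> 'k \<Rightarrow> 't) \<Rightarrow> bool" where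
  "tensor_product H K T t \<longleftrightarrow>
     hilbert_space H \<and> hilbert_space K \<and> hilbert_space T \<and>
     (\<forall>x \<in> carrier H. linear_map class_ring K T (\<lambda>y. t x y)) \<and>
     (\<forall>y \<in> carrier K. linear_map class_ring H T (\<lambda>x. t x y)) \<and>
     (\<forall>x \<in> carrier H. \<forall>x' \<in> carrier H. \<forall>y \<in> carrier K. \<forall>y' \<in> carrier K.
        ip T (t x y) (t x' y') = ip H x x' * ip K y y') \<and>
     Metric_space.mtopology (carrier T) (hdist T) closure_of
       module.span class_ring T {t x y | x y. x \<in> carrier H \<and> y \<in> carrier K} = carrier T"

text \<open>\<open>HH m n\<close> with elementary tensors \<open>tens m n x y\<close> is the tensor product of \<open>H m\<close> and
  \<open>H n\<close>. As all spaces are carried by one type, \<open>H 0\<close> being the complex numbers is expressed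
  by the unitary identification \<open>\<iota>\<close>.\<close>

locale subproduct_system =
  fixes H :: "nat \<Rightarrow> 'h hilbert"
    and HH :: "nat \<Rightarrow> nat \<Rightarrow> 'h hilbert"
    and tens :: "nat \<Rightarrow> nat \<Rightarrow> 'h \<Rightarrow> 'h \<Rightarrow> 'h"
    and w :: "nat \<Rightarrow> nat \<Rightarrow> 'h \<Rightarrow> 'h"
    and \<iota> :: "complex \<Rightarrow> 'h"
  assumes hilbert: "hilbert_space (H n)"
    and H_0: "unitary_operator complex_hilbert (H 0) \<iota>"
    and tensor: "tensor_product (H m) (H n) (HH m n) (tens m n)"
    and coiso: "coisometry (HH m n) (H (m + n)) (w m n)"
    and assoc: "\<lbrakk>x \<in> carrier (H m); y \<in> carrier (H n); z \<in> carrier (H k)\<rbrakk> \<Longrightarrow>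
        w (m + n) k (tens (m + n) k (w m n (tens m n x y)) z) =
        w m (n + k) (tens m (n + k) x (w n k (tens n k y z)))"
    and unit_left: "x \<in> carrier (H n) \<Longrightarrow> w 0 n (tens 0 n (\<iota> c) x) = c \<odot>\<^bsub>H n\<^esub> x"
    and unit_right: "x \<in> carrier (H n) \<Longrightarrow> w n 0 (tens n 0 x (\<iota> c)) = c \<odot>\<^bsub>H n\<^esub> x"

definition words :: "'a set \<Rightarrow> nat \<Rightarrow> 'a list set" where
  "words A n = {u \<in> lists A. length u = n}"

locale word_system =
  fixes A :: "'a set" and X :: "nat \<Rightarrow> 'a list set"
  assumes X_subset: "X n \<subseteq> words A n"
    and X_0: "X 0 = words A 0"
    and subword_closed: "\<lbrakk>u \<in> (\<Union>n. X n); y \<in> words A k; sublist y u\<rbrakk> \<Longrightarrow> y \<in> X k"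

end

theory Submission
  imports Defs "HOL-Library.List_Lexorder"
begin

text \<open>Given a subproduct system, let \<open>b\<^sub>i\<close> be a finite generating family of \<open>H\<^sub>1\<close> and let \<open>e\<^sub>u\<close> be the
  product of the \<open>b\<^sub>i\<close> along a word \<open>u\<close>. A vector of \<open>H\<^bsub>m+n\<^esub>\<close> orthogonal to all products is sent by
  the adjoint of the coisometry to a vector orthogonal to a dense subspace, hence is zero; by
  induction the \<open>e\<^sub>u\<close> with \<open>|u| = n\<close> span \<open>H\<^sub>n\<close>. Keep those words \<open>u\<close> for which \<open>e\<^sub>u\<close> is not a linear
  combination of the \<open>e\<^sub>v\<close> with \<open>v\<close> lexicographically smaller of the same length: their \<open>e\<^sub>u\<close> form
  a basis of \<open>H\<^sub>n\<close>, and a reducible subword makes the whole word reducible.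

  Conversely, a word system \<open>X\<close> yields \<open>H\<^sub>n = \<complex>\<^bsup>X n\<^esup>\<close> with \<open>e\<^sub>u e\<^sub>v = e\<^bsub>uv\<^esub>\<close> if \<open>uv\<close> belongs to \<open>X\<close>, and
  \<open>0\<close> otherwise. Only finitely many letters occur, so the words may be taken over the natural
  numbers, and the resulting spaces of complex functions fit into any type of at least the
  cardinality of the continuum.\<close>

section \<open>Word systems\<close>

lemma finite_words: "finite A \<Longrightarrow> finite (words A n)"
  by (simp add: words_def lists_eq_set finite_lists_length_eq)

text \<open>Equal length rules out that \<open>v\<close> is a proper prefix of \<open>y\<close>. The
  comparison is then decided at a first differing letter, and this letter stays decisive whatever
  prefix and suffix are attached.\<close>

lemma append_less_append:
  fixes v y :: "'i::linorder list"
  assumes "v < y" "length v = length y"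
  shows "p @ v @ s < p @ y @ s"
  using assms unfolding list_less_def by (intro lexord_append_leftI lexord_sufI) auto

text \<open>Serves to move between the letter type of the theorem and the natural numbers. A subword
  of \<open>map f v\<close> is the image of the subword of \<open>v\<close> at the same
  place.\<close>

lemma word_system_map:
  assumes "word_system A X" "inj_on f A"
  shows "word_system (f ` A) (\<lambda>n. map f ` X n)"
proof -
  interpret word_system A X by (rule assms(1))
  show ?thesis
  proof
    show "map f ` X n \<subseteq> words (f ` A) n" for n
      using X_subset[of n] unfolding words_def by fastforce
    show "map f ` X 0 = words (f ` A) 0"
      unfolding X_0 by (auto simp: words_def)
    fix u y k
    assume "u \<in> (\<Union>n. map f ` X n)" and y: "y \<in> words (f ` A) k" and sub: "sublist y u"
    then obtain n v where v: "v \<in> X n" "u = map f v" by auto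
    from sub obtain p s where "u = p @ y @ s" by (auto simp: sublist_def)
    then obtain y' where y': "sublist y' v" "y = map f y'"
      using v(2) by (force simp: map_eq_append_conv sublist_def append_eq_map_conv)
    have "y' \<in> words A k"
      using y y' v(1) X_subset[of n] set_mono_sublist[OF y'(1)] by (auto simp: words_def)
    then have "y' \<in> X k" using subword_closed v(1) y'(1) by blast
    then show "y \<in> map f ` X k" using y'(2) by blast
  qed
qed

lemma card_map_word_system:
  assumes "word_system A X" "inj_on f A"
  shows "card (map f ` X n) = card (X n)"
proof -
  have "X n \<subseteq> lists A" using word_system.X_subset[OF assms(1)] by (auto simp: words_def)
  then show ?thesis using inj_on_subset[OF inj_on_map_lists[OF assms(2)]] by (intro card_image) auto
qed

text \<open>Each letter of a word of the system is a subword of length one, hence lies in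
  \<open>X 1\<close>. The alphabet can thus be cut down to a finite one when \<open>X 1\<close> is
  finite.\<close>

lemma word_system_letters:
  assumes "word_system A X"
  shows "word_system {a. [a] \<in> X 1} X"
proof -
  interpret word_system A X by (rule assms)
  let ?A = "{a. [a] \<in> X 1}"
  have sub: "?A \<subseteq> A" using X_subset[of 1] by (auto simp: words_def)
  show ?thesis
  proof
    show "X n \<subseteq> words ?A n" for n
    proof
      fix u assume u: "u \<in> X n"
      have "[a] \<in> X 1" if a: "a \<in> set u" for a
      proof -
        obtain p s where "u = p @ [a] @ s" using split_list[OF a] by auto
        then have "sublist [a] u" by (auto simp: sublist_def)
        moreover have "[a] \<in> words A 1" using u a X_subset[of n] by (auto simp: words_def)
        ultimately show ?thesis using u subword_closed[of u "[a]" 1] by blast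
      qed
      then show "u \<in> words ?A n" using u X_subset[of n] by (auto simp: words_def)
    qed
    show "X 0 = words ?A 0" unfolding X_0 by (auto simp: words_def)
    show "y \<in> X k" if "u \<in> (\<Union>n. X n)" "y \<in> words ?A k" "sublist y u" for u y k
      using that sub subword_closed[of u y k] by (auto simp: words_def)
  qed
qed

section \<open>Linear algebra\<close>

lemma linear_map_iff:
  "linear_map K V W T \<longleftrightarrow> vectorspace K V \<and> vectorspace K W \<and> T \<in> module_hom K V W"
  by (auto simp: linear_map_def mod_hom_def mod_hom_axioms_def vectorspace_def)

lemma linear_map_compose:
  assumes "linear_map K U V S" "linear_map K V W T"
  shows "linear_map K U W (\<lambda>x. T (S x))"
  using assms unfolding linear_map_iff module_hom_def by (auto simp: Pi_iff)

text \<open>The preimage of a submodule is a submodule, so it contains the span of \<open>S\<close>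
  once it contains \<open>S\<close>.\<close>

lemma linear_map_span_vimage:
  assumes T: "linear_map K V W T"
    and S: "S \<subseteq> carrier V" and N: "submodule K N W" and TS: "\<And>s. s \<in> S \<Longrightarrow> T s \<in> N"
    and x: "x \<in> module.span K V S"
  shows "T x \<in> N"
proof -
  interpret linear_map K V W T by (rule T)
  interpret N: submodule K N W by (rule N)
  have "submodule K {x \<in> carrier V. T x \<in> N} V"
    by unfold_locales auto
  from V.module.span_is_subset[OF _ this, of S] show ?thesis using S TS x by auto
qed

context vectorspace
begin

text \<open>Greedy selection of a basis. Adding a new maximum \<open>b\<close> to \<open>W\<close>
  leaves the condition on the smaller indices unchanged; \<open>b\<close> is kept exactly if
  \<open>e b\<close> enlarges the span, and then independence survives.\<close>

lemma leading_vectors_span: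
  fixes e :: "'i::linorder \<Rightarrow> 'c"
  assumes "finite W" "e ` W \<subseteq> carrier V"
  defines "X \<equiv> {u \<in> W. e u \<notin> span (e ` {v \<in> W. v < u})}"
  shows "inj_on e X \<and> lin_indpt (e ` X) \<and> span (e ` X) = span (e ` W)"
  using assms(1,2) unfolding X_def
proof (induction W rule: finite_linorder_max_induct)
  case empty
  then show ?case by (simp add: lin_dep_def)
next
  case (insert b W)
  let ?X = "{u \<in> W. e u \<notin> span (e ` {v \<in> W. v < u})}"
  let ?X' = "{u \<in> insert b W. e u \<notin> span (e ` {v \<in> insert b W. v < u})}"
  have W: "e ` W \<subseteq> carrier V" and b: "e b \<in> carrier V" and X: "e ` ?X \<subseteq> carrier V"
    using insert.prems by auto
  have IH: "inj_on e ?X" "lin_indpt (e ` ?X)" "span (e ` ?X) = span (e ` W)"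
    using insert.IH W by auto
  have "{v \<in> insert b W. v < u} = {v \<in> W. v < u}" if "u \<in> W" for u
    using insert.hyps that by auto
  moreover have "{v \<in> insert b W. v < b} = W"
    using insert.hyps by auto
  ultimately have X': "?X' = (if e b \<in> span (e ` W) then ?X else insert b ?X)"
    by auto
  show ?case
  proof (cases "e b \<in> span (e ` W)")
    case True
    then have "span (e ` insert b W) = span (e ` W)"
      using already_in_span[OF W True] by simp
    with True X' IH show ?thesis by simp
  next
    case False
    then have nin: "e b \<notin> span (e ` ?X)" using IH by simp
    then have nin': "e b \<notin> e ` ?X" using in_own_span[OF X] by blast
    have "lin_indpt (insert (e b) (e ` ?X))"
      using lin_dep_iff_in_span[OF X IH(2) b nin'] nin by simp
    moreover have "inj_on e (insert b ?X)"
      using nin' IH(1) by (auto simp: inj_on_insert)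
    moreover have "span (insert (e b) (e ` ?X)) = span (insert (e b) (e ` W))"
    proof
      show "span (insert (e b) (e ` ?X)) \<subseteq> span (insert (e b) (e ` W))"
        by (rule span_is_monotone) auto
      have "e ` W \<subseteq> span (insert (e b) (e ` ?X))"
        using in_own_span[OF W] IH(3) span_is_monotone[of "e ` ?X" "insert (e b) (e ` ?X)"] by auto
      moreover have "e b \<in> span (insert (e b) (e ` ?X))"
        using in_own_span[of "insert (e b) (e ` ?X)"] X b by auto
      ultimately show "span (insert (e b) (e ` W)) \<subseteq> span (insert (e b) (e ` ?X))"
        by (intro span_is_subset span_is_submodule) (use X b in auto)
    qed
    ultimately show ?thesis
      unfolding X' using False by simp
  qed
qed

end

section \<open>Inner product spaces\<close>

text \<open>\<open>hilbert_space\<close> without completeness: the metric of a coordinate space is needed before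
  its completeness can be proved.\<close>

locale pre_hilbert_space = vectorspace "class_ring :: complex ring" H
  for H :: "'h hilbert" (structure) +
  assumes ip_add_right: "\<lbrakk>x \<in> carrier H; y \<in> carrier H; z \<in> carrier H\<rbrakk>
      \<Longrightarrow> ip H x (y \<oplus> z) = ip H x y + ip H x z"
    and ip_smult_right: "\<lbrakk>x \<in> carrier H; y \<in> carrier H\<rbrakk> \<Longrightarrow> ip H x (c \<odot> y) = c * ip H x y"
    and ip_commute: "\<lbrakk>x \<in> carrier H; y \<in> carrier H\<rbrakk> \<Longrightarrow> ip H y x = cnj (ip H x y)"
    and ip_nonneg: "x \<in> carrier H \<Longrightarrow> 0 \<le> Re (ip H x x)"
    and ip_definite: "\<lbrakk>x \<in> carrier H; ip H x x = 0\<rbrakk> \<Longrightarrow> x = \<zero>"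
begin

lemma ip_add_left:
  "\<lbrakk>x \<in> carrier H; y \<in> carrier H; z \<in> carrier H\<rbrakk> \<Longrightarrow> ip H (x \<oplus> y) z = ip H x z + ip H y z"
  using ip_add_right[of z x y] ip_commute[of z] by simp

lemma ip_smult_left:
  "\<lbrakk>x \<in> carrier H; y \<in> carrier H\<rbrakk> \<Longrightarrow> ip H (c \<odot> x) y = cnj c * ip H x y"
  using ip_smult_right[of y x c] ip_commute[of y] by simp

lemma ip_zero_right: "x \<in> carrier H \<Longrightarrow> ip H x \<zero> = 0"
  using ip_smult_right[of x "\<zero>" 0] by simp

lemma ip_zero_left: "x \<in> carrier H \<Longrightarrow> ip H \<zero> x = 0"
  using ip_smult_left[of "\<zero>" x 0] by simp

lemma minus_eq_smult: "x \<in> carrier H \<Longrightarrow> \<ominus> x = (-1) \<odot> x"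
  using smult_l_minus[of 1 x] smult_one[of x] by (simp add: class_ring_simps)

lemma minus_eq_zero_iff: "\<lbrakk>x \<in> carrier H; y \<in> carrier H\<rbrakk> \<Longrightarrow> x \<ominus> y = \<zero> \<longleftrightarrow> x = y"
  by simp

lemma ip_minus_right:
  "\<lbrakk>x \<in> carrier H; y \<in> carrier H; z \<in> carrier H\<rbrakk> \<Longrightarrow> ip H x (y \<ominus> z) = ip H x y - ip H x z"
  using ip_add_right[of x y "\<ominus> z"] ip_smult_right[of x z "-1"] by (simp add: a_minus_def minus_eq_smult)

lemma ip_minus_left:
  "\<lbrakk>x \<in> carrier H; y \<in> carrier H; z \<in> carrier H\<rbrakk> \<Longrightarrow> ip H (x \<ominus> y) z = ip H x z - ip H y z"
  using ip_minus_right[of z x y] ip_commute[of z] by simp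

lemma submodule_orthogonal:
  assumes "y \<in> carrier H"
  shows "submodule class_ring {x \<in> carrier H. ip H x y = 0} H"
  by unfold_locales (use assms in \<open>auto simp: ip_add_left ip_smult_left ip_zero_left\<close>)

text \<open>A Gram-Schmidt step. Project \<open>x\<close> and \<open>b\<close> onto
  \<open>span B\<close>, with results \<open>p\<close> and \<open>q\<close>; a suitable multiple of
  the residual \<open>b \<ominus> q\<close> added to \<open>p\<close> yields orthogonality to
  \<open>b\<close> and keeps that to \<open>B\<close>. The induction leaves \<open>x\<close>
  arbitrary because its hypothesis is also applied to \<open>b\<close>.\<close>

lemma ex_orthogonal_projection:
  assumes "finite B" "B \<subseteq> carrier H" "x \<in> carrier H"
  shows "\<exists>p \<in> span B. \<forall>b \<in> B. ip H b (x \<ominus> p) = 0"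
  using assms
proof (induction B arbitrary: x)
  case empty
  have "\<zero> \<in> span {}"
    using span_is_submodule[of "{}"] submodule.zero_closed by blast
  then show ?case by auto
next
  case (insert b B)
  have B: "B \<subseteq> carrier H" and b: "b \<in> carrier H" using insert.prems by auto
  have sub: "submodule class_ring (span (insert b B)) H"
    using insert.prems(1) by (rule span_is_submodule)
  have spanB: "span B \<subseteq> span (insert b B)" by (rule span_is_monotone) auto
  have bspan: "b \<in> span (insert b B)" using in_own_span[OF insert.prems(1)] by auto
  have cl: "v \<in> carrier H" if "v \<in> span B" for v
    using that span_is_subset2[OF B] by blast
  have diff: "u \<ominus> v \<in> span (insert b B)" if "u \<in> span (insert b B)" "v \<in> span (insert b B)" for u v
    using that span_is_subset2[OF insert.prems(1)] submodule.m_closed[OF sub] submodule.smult_closed[OF sub, of "-1"]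
    by (auto simp: a_minus_def minus_eq_smult)
  obtain p where p: "p \<in> span B" "\<And>a. a \<in> B \<Longrightarrow> ip H a (x \<ominus> p) = 0"
    using insert.IH[OF B insert.prems(2)] by blast
  obtain q where q: "q \<in> span B" "\<And>a. a \<in> B \<Longrightarrow> ip H a (b \<ominus> q) = 0"
    using insert.IH[OF B b] by blast
  have pc: "p \<in> carrier H" and qc: "q \<in> carrier H" using p q cl by auto
  \<comment> \<open>This coefficient makes \<open>x \<ominus> r\<close> orthogonal to
    \<open>b \<ominus> q\<close>. If the residual is zero, that orthogonality is trivial, whence the
    later case distinction.\<close>
  define c where "c = ip H (b \<ominus> q) (x \<ominus> p) / ip H (b \<ominus> q) (b \<ominus> q)"
  define r where "r = p \<oplus> c \<odot> (b \<ominus> q)"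
  have r: "r \<in> span (insert b B)"
    unfolding r_def using p(1) q(1) spanB bspan diff
    by (intro submodule.m_closed[OF sub] submodule.smult_closed[OF sub]) auto
  have rc: "r \<in> carrier H" unfolding r_def using pc qc b by simp
  have ipr: "ip H a (x \<ominus> r) = ip H a (x \<ominus> p) - c * ip H a (b \<ominus> q)" if "a \<in> carrier H" for a
    using that pc qc b insert.prems(2) rc
    by (simp add: r_def ip_minus_right ip_add_right ip_smult_right)
  have orthB: "ip H a (x \<ominus> r) = 0" if "a \<in> B" for a
    using that B p q by (subst ipr) auto
  have "ip H (b \<ominus> q) (x \<ominus> r) = 0"
  proof (cases "b \<ominus> q = \<zero>")
    case True
    then show ?thesis using insert.prems(2) rc by (simp add: ip_zero_left)
  next
    case False
    then have "ip H (b \<ominus> q) (b \<ominus> q) \<noteq> 0" using ip_definite b qc by blast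
    then show ?thesis using b qc by (subst ipr) (auto simp: c_def)
  qed
  \<comment> \<open>The vector \<open>b\<close> is the sum of \<open>b \<ominus> q\<close> and
    \<open>q\<close>, so orthogonality to both suffices. For \<open>q\<close> it follows from
    \<open>q \<in> span B\<close>.\<close>
  moreover have "ip H q (x \<ominus> r) = 0"
    using span_is_subset[OF _ submodule_orthogonal[of "x \<ominus> r"], of B] B orthB q(1) rc insert.prems(2) by auto
  ultimately have "ip H b (x \<ominus> r) = 0"
    using b qc rc insert.prems(2) by (simp add: ip_minus_left)
  with orthB r show ?case by auto
qed

section \<open>Norm, Cauchy-Schwarz inequality and the induced metric\<close>

lemma ip_self: "x \<in> carrier H \<Longrightarrow> ip H x x = of_real ((hnorm H x)\<^sup>2)"
  using ip_commute[of x x] ip_nonneg[of x] by (simp add: hnorm_def complex_eq_iff)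

lemma hnorm_nonneg: "x \<in> carrier H \<Longrightarrow> 0 \<le> hnorm H x"
  using ip_nonneg by (simp add: hnorm_def)

lemma hnorm_eq_0_iff: "x \<in> carrier H \<Longrightarrow> hnorm H x = 0 \<longleftrightarrow> x = \<zero>"
  using ip_self[of x] ip_definite[of x] by (auto simp: hnorm_def ip_zero_left)

lemma Re_ip_commute: "\<lbrakk>x \<in> carrier H; y \<in> carrier H\<rbrakk> \<Longrightarrow> Re (ip H x y) = Re (ip H y x)"
  using ip_commute[of x y] by simp

lemma hnorm_minus_sq:
  assumes "x \<in> carrier H" "y \<in> carrier H"
  shows "(hnorm H (x \<ominus> y))\<^sup>2 = (hnorm H x)\<^sup>2 - 2 * Re (ip H x y) + (hnorm H y)\<^sup>2"
  using assms ip_nonneg[of x] ip_nonneg[of y] ip_nonneg[of "x \<ominus> y"] Re_ip_commute[of x y]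
  by (simp add: hnorm_def ip_minus_left ip_minus_right)

lemma hnorm_smult_real:
  assumes "x \<in> carrier H"
  shows "(hnorm H (of_real c \<odot> x))\<^sup>2 = c\<^sup>2 * (hnorm H x)\<^sup>2"
  using assms ip_nonneg[of x]
  by (simp add: hnorm_def ip_smult_left ip_smult_right power2_eq_square abs_mult)

text \<open>Cauchy-Schwarz for the real part, read off from the nonnegative squared norm of
  \<open>x\<close> scaled by the norm of \<open>y\<close> minus \<open>y\<close> scaled by the norm
  of \<open>x\<close>.\<close>

lemma Re_ip_le:
  assumes x: "x \<in> carrier H" and y: "y \<in> carrier H"
  shows "Re (ip H x y) \<le> hnorm H x * hnorm H y"
proof (cases "x = \<zero> \<or> y = \<zero>")
  case True
  then show ?thesis using x y by (auto simp: ip_zero_left ip_zero_right hnorm_nonneg)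
next
  case False
  let ?a = "hnorm H x" and ?b = "hnorm H y"
  have pos: "?a > 0" "?b > 0"
    using False x y hnorm_nonneg hnorm_eq_0_iff by (metis less_eq_real_def)+
  have "0 \<le> (hnorm H (of_real ?b \<odot> x \<ominus> of_real ?a \<odot> y))\<^sup>2" by simp
  also have "\<dots> = ?b\<^sup>2 * ?a\<^sup>2 - 2 * (?b * ?a * Re (ip H x y)) + ?a\<^sup>2 * ?b\<^sup>2"
    using x y by (subst hnorm_minus_sq)
      (auto simp: hnorm_smult_real ip_smult_left ip_smult_right algebra_simps)
  finally have "(?a * ?b) * Re (ip H x y) \<le> (?a * ?b) * (?a * ?b)"
    by (simp add: power2_eq_square algebra_simps)
  then show ?thesis using pos by simp
qed

text \<open>The triangle inequality, by squaring and applying Cauchy-Schwarz to \<open>x\<close> and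
  \<open>(-1) \<odot> y\<close>.\<close>

lemma hnorm_minus_le:
  assumes "x \<in> carrier H" "y \<in> carrier H"
  shows "hnorm H (x \<ominus> y) \<le> hnorm H x + hnorm H y"
proof (rule power2_le_imp_le)
  have "Re (ip H x ((-1) \<odot> y)) \<le> hnorm H x * hnorm H ((-1) \<odot> y)"
    using assms by (intro Re_ip_le) auto
  moreover have "hnorm H ((-1) \<odot> y) = hnorm H y"
    using assms by (simp add: hnorm_def ip_smult_left ip_smult_right)
  ultimately have "- Re (ip H x y) \<le> hnorm H x * hnorm H y"
    using assms by (simp add: ip_smult_right)
  then show "(hnorm H (x \<ominus> y))\<^sup>2 \<le> (hnorm H x + hnorm H y)\<^sup>2"
    using assms by (simp add: hnorm_minus_sq power2_sum)
  show "0 \<le> hnorm H x + hnorm H y" using assms by (simp add: hnorm_nonneg)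
qed

lemma Metric_space_hdist: "Metric_space (carrier H) (hdist H)"
proof
  show "0 \<le> hdist H x y" for x y by (simp add: hdist_def hnorm_nonneg)
  have comm: "hnorm H (x \<ominus> y) = hnorm H (y \<ominus> x)" if "x \<in> carrier H" "y \<in> carrier H" for x y
    by (rule power2_eq_imp_eq)
      (use that hnorm_minus_sq[of x y] hnorm_minus_sq[of y x] Re_ip_commute[of x y]
        in \<open>auto simp: hnorm_nonneg\<close>)
  show "hdist H x y = hdist H y x" for x y by (simp add: hdist_def comm)
  show "hdist H x y = 0 \<longleftrightarrow> x = y" if "x \<in> carrier H" "y \<in> carrier H" for x y
    using that by (simp add: hdist_def hnorm_eq_0_iff)
  show "hdist H x z \<le> hdist H x y + hdist H y z"
    if "x \<in> carrier H" "y \<in> carrier H" "z \<in> carrier H" for x y z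
  proof -
    have "x \<ominus> z = (x \<ominus> y) \<ominus> (z \<ominus> y)"
      using that a_comm[of x "\<ominus> z"]
      by (simp add: a_minus_def minus_add a_assoc minus_minus a_lcomm l_neg r_neg)
    then have "hnorm H (x \<ominus> z) \<le> hnorm H (x \<ominus> y) + hnorm H (z \<ominus> y)"
      using that hnorm_minus_le[of "x \<ominus> y" "z \<ominus> y"] by simp
    then show ?thesis using that comm[of y z] by (simp add: hdist_def)
  qed
qed

text \<open>If \<open>y\<close> were nonzero, the open ball around \<open>y\<close> whose radius is
  the norm of \<open>y\<close> would meet the dense span. Every vector of the span is orthogonal to
  \<open>y\<close>, so by Pythagoras its distance from \<open>y\<close> is at least that
  radius.\<close>

lemma orthogonal_to_dense_zero:
  assumes S: "S \<subseteq> carrier H"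
    and dense: "Metric_space.mtopology (carrier H) (hdist H) closure_of span S = carrier H"
    and y: "y \<in> carrier H" "\<And>s. s \<in> S \<Longrightarrow> ip H s y = 0"
  shows "y = \<zero>"
proof (rule ccontr)
  interpret M: Metric_space "carrier H" "hdist H" by (rule Metric_space_hdist)
  assume "y \<noteq> \<zero>"
  then have pos: "hnorm H y > 0" using y(1) hnorm_nonneg hnorm_eq_0_iff by (metis less_eq_real_def)
  have "y \<in> M.mtopology closure_of span S" using dense y(1) by simp
  then obtain s where s: "s \<in> span S" "s \<in> M.mball y (hnorm H y)"
    using pos unfolding M.metric_closure_of by blast
  have sc: "s \<in> carrier H" using s(2) by auto
  have "ip H s y = 0"
    using span_is_subset[OF _ submodule_orthogonal[OF y(1)], of S] S y(2) s(1) by auto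
  then have "(hnorm H y)\<^sup>2 \<le> (hnorm H (y \<ominus> s))\<^sup>2"
    using hnorm_minus_sq[OF y(1) sc] Re_ip_commute[OF y(1) sc] by simp
  moreover have "hnorm H (y \<ominus> s) < hnorm H y"
    using s(2) sc y(1) by (simp add: hdist_def)
  ultimately show False
    using power_strict_mono[of "hnorm H (y \<ominus> s)" "hnorm H y" 2] hnorm_nonneg sc y(1) by simp
qed

end

lemma hilbert_space_iff:
  "hilbert_space H \<longleftrightarrow> pre_hilbert_space H \<and> Metric_space.mcomplete (carrier H) (hdist H)"
  unfolding hilbert_space_def hilbert_space_axioms_def pre_hilbert_space_def
    pre_hilbert_space_axioms_def by blast

sublocale hilbert_space \<subseteq> pre_hilbert_space
  using hilbert_space_axioms by (simp add: hilbert_space_iff)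

section \<open>The leading words of a subproduct system\<close>

context subproduct_system
begin

definition mul :: "nat \<Rightarrow> nat \<Rightarrow> 'h \<Rightarrow> 'h \<Rightarrow> 'h" where
  "mul m n x y = w m n (tens m n x y)"

lemma H_vectorspace: "vectorspace class_ring (H n)"
  using hilbert by (simp add: hilbert_space_def)

lemma linear_w: "linear_map class_ring (HH m n) (H (m + n)) (w m n)"
  using coiso[of m n] by (simp add: coisometry_def bounded_operator_def)

lemma linear_mul_right:
  "x \<in> carrier (H m) \<Longrightarrow> linear_map class_ring (H n) (H (m + n)) (\<lambda>y. mul m n x y)"
  unfolding mul_def
  by (rule linear_map_compose[OF _ linear_w]) (use tensor[of m n] in \<open>auto simp: tensor_product_def\<close>)

lemma linear_mul_left:
  "y \<in> carrier (H n) \<Longrightarrow> linear_map class_ring (H m) (H (m + n)) (\<lambda>x. mul m n x y)"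
  unfolding mul_def
  by (rule linear_map_compose[OF _ linear_w]) (use tensor[of m n] in \<open>auto simp: tensor_product_def\<close>)

lemma mul_closed:
  "\<lbrakk>x \<in> carrier (H m); y \<in> carrier (H n)\<rbrakk> \<Longrightarrow> mul m n x y \<in> carrier (H (m + n))"
  using linear_mul_right by (simp add: linear_map_iff module_hom_def Pi_iff)

text \<open>For an adjoint \<open>S\<close> of \<open>w m n\<close>, the inner products of
  \<open>S y\<close> with elementary tensors are those of \<open>y\<close> with products. So
  \<open>S y\<close> is zero by density, and \<open>y = w m n (S y)\<close> is zero too.\<close>

lemma orthogonal_to_products_zero:
  assumes y: "y \<in> carrier (H (m + n))"
    and orth: "\<And>a b. \<lbrakk>a \<in> carrier (H m); b \<in> carrier (H n)\<rbrakk> \<Longrightarrow> ip (H (m + n)) (mul m n a b) y = 0"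
  shows "y = \<zero>\<^bsub>H (m + n)\<^esub>"
proof -
  interpret T: hilbert_space "HH m n" using tensor[of m n] by (simp add: tensor_product_def)
  interpret w: linear_map class_ring "HH m n" "H (m + n)" "w m n" by (rule linear_w)
  let ?S = "{tens m n a b |a b. a \<in> carrier (H m) \<and> b \<in> carrier (H n)}"
  obtain S where S: "is_adjoint_of (HH m n) (H (m + n)) (w m n) S"
    "\<And>z. z \<in> carrier (H (m + n)) \<Longrightarrow> w m n (S z) = z"
    using coiso[of m n] by (auto simp: coisometry_def)
  have Sy: "S y \<in> carrier (HH m n)"
    using S(1) y by (auto simp: is_adjoint_of_def bounded_operator_def linear_map_iff module_hom_def)
  have sub: "?S \<subseteq> carrier (HH m n)"
    using tensor[of m n] by (auto simp: tensor_product_def linear_map_iff module_hom_def Pi_iff)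
  have "S y = \<zero>\<^bsub>HH m n\<^esub>"
  proof (rule T.orthogonal_to_dense_zero[OF sub _ Sy])
    show "Metric_space.mtopology (carrier (HH m n)) (hdist (HH m n)) closure_of T.span ?S = carrier (HH m n)"
      using tensor[of m n] by (simp add: tensor_product_def)
    show "ip (HH m n) s (S y) = 0" if s: "s \<in> ?S" for s
    proof -
      obtain a b where ab: "s = tens m n a b" "a \<in> carrier (H m)" "b \<in> carrier (H n)"
        using s by blast
      have "ip (HH m n) s (S y) = ip (H (m + n)) (w m n s) y"
        using S(1) y sub s unfolding is_adjoint_of_def by (meson subsetD)
      then show ?thesis using orth[OF ab(2,3)] ab(1) by (simp add: mul_def)
    qed
  qed
  then show ?thesis using S(2)[OF y] w.T0_is_0 by simp
qed

section \<open>Products of generators along words\<close>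

primrec word_vec :: "(nat \<Rightarrow> 'h) \<Rightarrow> nat list \<Rightarrow> 'h" where
  "word_vec b [] = \<iota> 1"
| "word_vec b (i # v) = mul 1 (length v) (b i) (word_vec b v)"

context
  fixes A :: "nat set" and b :: "nat \<Rightarrow> 'h"
  assumes fin: "finite A" and bc: "b ` A \<subseteq> carrier (H 1)"
    and gen: "module.span class_ring (H 1) (b ` A) = carrier (H 1)"
begin

lemma bij_iota: "bij_betw \<iota> UNIV (carrier (H 0))"
  using H_0 by (simp add: unitary_operator_def complex_hilbert_def)

lemma iota_mult: "\<iota> (c * a) = c \<odot>\<^bsub>H 0\<^esub> \<iota> a"
  using H_0 by (simp add: unitary_operator_def linear_map_iff module_hom_def complex_hilbert_def)

lemma iota_closed: "\<iota> c \<in> carrier (H 0)"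
  using bij_iota by (auto simp: bij_betw_def)

lemma word_vec_closed: "u \<in> lists A \<Longrightarrow> word_vec b u \<in> carrier (H (length u))"
proof (induction u)
  case Nil
  then show ?case by (simp add: iota_closed)
next
  case (Cons i u)
  then show ?case using mul_closed[of "b i" 1 "word_vec b u" "length u"] bc by auto
qed

lemma word_vec_words: "word_vec b ` words A n \<subseteq> carrier (H n)"
  using word_vec_closed by (auto simp: words_def)

text \<open>The left unit law settles the empty word, and associativity moves the bracket past one
  letter.\<close>

lemma word_vec_append:
  "\<lbrakk>u \<in> lists A; v \<in> lists A\<rbrakk> \<Longrightarrow>
    word_vec b (u @ v) = mul (length u) (length v) (word_vec b u) (word_vec b v)"
proof (induction u)
  case Nil
  interpret H: vectorspace class_ring "H (length v)" by (rule H_vectorspace)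
  show ?case
    using unit_left[of "word_vec b v" "length v" 1] word_vec_closed[OF Nil(2)] H.smult_one
    by (simp add: mul_def)
next
  case (Cons i u)
  then show ?case
    using assoc[of "b i" 1 "word_vec b u" "length u" "word_vec b v" "length v"] bc
      word_vec_closed[of u] word_vec_closed[of v]
    by (auto simp: mul_def)
qed

text \<open>In the induction step the residual \<open>y\<close> of the projection of
  \<open>x\<close> onto the finite span is orthogonal to all word vectors. Bilinearity extends this
  to all products of degrees \<open>1\<close> and \<open>n\<close>, so \<open>y\<close> is
  zero.\<close>

lemma span_word_vec: "module.span class_ring (H n) (word_vec b ` words A n) = carrier (H n)"
proof (induction n)
  case 0
  interpret H: vectorspace class_ring "H 0" by (rule H_vectorspace)
  have w0: "words A 0 = {[]}" by (auto simp: words_def)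
  have sub: "submodule class_ring (H.span {\<iota> 1}) (H 0)"
    using iota_closed by (intro H.span_is_submodule) auto
  have "\<iota> 1 \<in> H.span {\<iota> 1}" using H.in_own_span[of "{\<iota> 1}"] iota_closed by auto
  then have sm: "c \<odot>\<^bsub>H 0\<^esub> \<iota> 1 \<in> H.span {\<iota> 1}" for c
    by (intro submodule.smult_closed[OF sub]) auto
  have "x \<in> H.span {\<iota> 1}" if x: "x \<in> carrier (H 0)" for x
  proof -
    have "x \<in> range \<iota>" using bij_iota x by (simp add: bij_betw_def)
    then obtain c where c: "x = \<iota> c" by blast
    then show ?thesis using sm[of c] iota_mult[of c 1] by simp
  qed
  then show ?case
    using H.span_is_subset2[of "{\<iota> 1}"] iota_closed by (auto simp: w0)
next
  case (Suc n)
  interpret H: hilbert_space "H (1 + n)" by (rule hilbert)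
  interpret Hn: vectorspace class_ring "H n" by (rule H_vectorspace)
  let ?B = "word_vec b ` words A (1 + n)"
  have B: "finite ?B" "?B \<subseteq> carrier (H (1 + n))"
    using finite_words[OF fin] word_vec_words by blast+
  have "x \<in> H.span ?B" if x: "x \<in> carrier (H (1 + n))" for x
  proof -
    obtain p where p: "p \<in> H.span ?B" "\<And>v. v \<in> ?B \<Longrightarrow> ip (H (1 + n)) v (x \<ominus>\<^bsub>H (1 + n)\<^esub> p) = 0"
      using H.ex_orthogonal_projection[OF B x] by blast
    define y where "y = x \<ominus>\<^bsub>H (1 + n)\<^esub> p"
    have pc: "p \<in> carrier (H (1 + n))" using p(1) H.span_is_subset2[OF B(2)] by blast
    then have y: "y \<in> carrier (H (1 + n))" unfolding y_def using x by (intro H.minus_closed)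
    note N = H.submodule_orthogonal[OF y]
    have 1: "mul 1 n (b i) (word_vec b v) \<in> {x \<in> carrier (H (1 + n)). ip (H (1 + n)) x y = 0}"
      if "i \<in> A" "v \<in> words A n" for i v
    proof -
      have "word_vec b (i # v) \<in> ?B" using that by (intro imageI) (auto simp: words_def)
      with p(2)[folded y_def] B(2) that(2) show ?thesis by (auto simp: words_def)
    qed
    \<comment> \<open>Linearity in the right factor: by the induction hypothesis the word vectors of
      length \<open>n\<close> span \<open>H n\<close>.\<close>
    have 2: "mul 1 n (b i) z \<in> {x \<in> carrier (H (1 + n)). ip (H (1 + n)) x y = 0}"
      if "i \<in> A" "z \<in> carrier (H n)" for i z
      by (rule linear_map_span_vimage[OF linear_mul_right[of "b i" 1 n] _ N, of "word_vec b ` words A n"])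
        (use that bc 1 word_vec_words[of n] Suc.IH in auto)
    \<comment> \<open>Linearity in the left factor: the generators span \<open>H 1\<close>.\<close>
    have 3: "mul 1 n a z \<in> {x \<in> carrier (H (1 + n)). ip (H (1 + n)) x y = 0}"
      if "a \<in> carrier (H 1)" "z \<in> carrier (H n)" for a z
      by (rule linear_map_span_vimage[OF linear_mul_left[of z n 1] _ N, of "b ` A"])
        (use that bc 2 gen in auto)
    have "y = \<zero>\<^bsub>H (1 + n)\<^esub>"
      using 3 by (intro orthogonal_to_products_zero[OF y]) auto
    then have "x = p" unfolding y_def using H.minus_eq_zero_iff[OF x pc] by blast
    with p(1) show ?thesis by simp
  qed
  then show ?case using H.span_is_subset2[OF B(2)] by auto
qed

text \<open>These are the standard monomials of a noncommutative Groebner basis for the lexicographic order.\<close>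

definition leading_words :: "nat \<Rightarrow> nat list set" where
  "leading_words n = {u \<in> words A n.
     word_vec b u \<notin> module.span class_ring (H n) (word_vec b ` {v \<in> words A n. v < u})}"

text \<open>If the vector of \<open>y\<close> is a combination of vectors of smaller words
  \<open>v\<close>, then multiplication by the vectors of \<open>p\<close> and \<open>s\<close> on
  both sides expresses that of \<open>p @ y @ s\<close> by those of \<open>p @ v @ s\<close>, which
  are smaller words.\<close>

lemma word_system_leading_words: "word_system A leading_words"
proof
  show "leading_words n \<subseteq> words A n" for n by (auto simp: leading_words_def)
  interpret H0: vectorspace class_ring "H 0" by (rule H_vectorspace)
  \<comment> \<open>No word of length \<open>0\<close> precedes the empty word, so it is leading
    because the unit lies outside the zero span of the empty set.\<close>
  have "\<iota> 1 \<noteq> \<zero>\<^bsub>H 0\<^esub>"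
  proof
    assume "\<iota> 1 = \<zero>\<^bsub>H 0\<^esub>"
    moreover have "linear_map class_ring complex_hilbert (H 0) \<iota>"
      using H_0 by (simp add: unitary_operator_def)
    then have "\<iota> 0 = \<zero>\<^bsub>H 0\<^esub>"
      using mod_hom.f0_is_0[of class_ring complex_hilbert "H 0" \<iota>]
      by (simp add: linear_map_def complex_hilbert_def)
    ultimately show False
      using bij_iota by (auto simp: bij_betw_def dest: injD[of \<iota> 1 0])
  qed
  moreover have "words A 0 = {[]}" by (auto simp: words_def)
  moreover have "H0.span {} = {\<zero>\<^bsub>H 0\<^esub>}" by (auto simp: H0.span_def H0.lincomb_def)
  ultimately show "leading_words 0 = words A 0" by (auto simp: leading_words_def)
  fix u y k
  assume "u \<in> (\<Union>n. leading_words n)" and y: "y \<in> words A k" and sub: "sublist y u"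
  then obtain n where n: "u \<in> leading_words n" by auto
  from sub obtain p s where u: "u = p @ y @ s" by (auto simp: sublist_def)
  have wu: "u \<in> words A n" using n by (simp add: leading_words_def)
  have len: "n = length p + (k + length s)" "length y = k" and li: "p \<in> lists A" "y \<in> lists A" "s \<in> lists A"
    using wu u y by (auto simp: words_def)
  interpret H: vectorspace class_ring "H n" by (rule H_vectorspace)
  let ?L = "\<lambda>a. mul (length p) (k + length s) (word_vec b p) (mul k (length s) a (word_vec b s))"
  have L: "linear_map class_ring (H k) (H n) ?L"
    unfolding len using li by (intro linear_map_compose[OF linear_mul_left linear_mul_right] word_vec_closed)
  have Lv: "?L (word_vec b v) = word_vec b (p @ v @ s)" if "v \<in> words A k" for v
    using that li by (auto simp: word_vec_append words_def)
  show "y \<in> leading_words k"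
  proof (rule ccontr)
    assume "y \<notin> leading_words k"
    then have red: "word_vec b y \<in> module.span class_ring (H k) (word_vec b ` {v \<in> words A k. v < y})"
      using y by (simp add: leading_words_def)
    let ?N = "H.span (word_vec b ` {v \<in> words A n. v < u})"
    have Nc: "word_vec b ` {v \<in> words A n. v < u} \<subseteq> carrier (H n)"
      using word_vec_words[of n] by auto
    have "?L (word_vec b y) \<in> ?N"
    proof (rule linear_map_span_vimage[OF L _ H.span_is_submodule[OF Nc] _ red])
      show "word_vec b ` {v \<in> words A k. v < y} \<subseteq> carrier (H k)"
        using word_vec_words[of k] by auto
      fix a assume "a \<in> word_vec b ` {v \<in> words A k. v < y}"
      then obtain v where v: "a = word_vec b v" "v \<in> words A k" "v < y" by auto
      then have "p @ v @ s < u" "p @ v @ s \<in> words A n"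
        using append_less_append[of v y p s] u len li by (auto simp: words_def)
      then show "?L a \<in> ?N"
        using H.in_own_span[OF Nc] v Lv by auto
    qed
    then show False using n u Lv[OF y] by (simp add: leading_words_def)
  qed
qed

text \<open>The vectors of the leading words form a basis, and injectivity carries the count from
  vectors back to words.\<close>

lemma card_leading_words:
  "finite (leading_words n)" "card (leading_words n) = vectorspace.dim class_ring (H n)"
proof -
  interpret H: vectorspace class_ring "H n" by (rule H_vectorspace)
  show fin': "finite (leading_words n)"
    using finite_words[OF fin, of n] by (simp add: leading_words_def)
  have *: "inj_on (word_vec b) (leading_words n) \<and> H.lin_indpt (word_vec b ` leading_words n) \<and>
      H.span (word_vec b ` leading_words n) = H.span (word_vec b ` words A n)"
    unfolding leading_words_def
    by (rule H.leading_vectors_span[OF finite_words[OF fin] word_vec_words])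
  moreover have "word_vec b ` leading_words n \<subseteq> carrier (H n)"
    using word_vec_words by (auto simp: leading_words_def)
  ultimately have "H.basis (word_vec b ` leading_words n)"
    by (simp add: H.basis_def span_word_vec)
  then have "H.dim = card (word_vec b ` leading_words n)"
    using fin' by (intro H.dim_basis) auto
  then show "card (leading_words n) = H.dim"
    using * by (simp add: card_image)
qed

end

text \<open>A finite spanning set of \<open>H 1\<close> is numbered by naturals, which become the
  letters. Degree one is enough, since products of generators span every other degree.\<close>

lemma ex_word_system:
  assumes "vectorspace.fin_dim class_ring (H 1)"
  shows "\<exists>(A :: nat set) X. word_system A X \<and>
    (\<forall>n. finite (X n) \<and> card (X n) = vectorspace.dim class_ring (H n))"
proof -
  interpret H: vectorspace class_ring "H 1" by (rule H_vectorspace)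
  obtain \<beta> where \<beta>: "finite \<beta>" "\<beta> \<subseteq> carrier (H 1)" "H.span \<beta> = carrier (H 1)"
    using assms unfolding H.fin_dim_def by blast
  obtain b :: "nat \<Rightarrow> 'h" and n where b: "\<beta> = b ` {i. i < n}"
    using finite_imp_nat_seg_image_inj_on[OF \<beta>(1)] by blast
  then show ?thesis
    using \<beta> word_system_leading_words[of "{i. i < n}" b] card_leading_words[of "{i. i < n}" b]
    by blast
qed

end

section \<open>Coordinate Hilbert spaces\<close>

text \<open>Countably many complex numbers can be coded by one set of naturals, hence by one real
  number, hence by an element of \<open>'h\<close>.\<close>

lemma ex_inj_complex_functions:
  assumes "(UNIV :: complex set) \<lesssim> (UNIV :: 'h set)"
  shows "\<exists>g :: ('i::countable \<Rightarrow> complex) \<Rightarrow> 'h. inj g"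
proof -
  obtain h :: "complex \<Rightarrow> 'h" where h: "inj h" using assms by (auto simp: lepoll_def)
  obtain r :: "nat set \<Rightarrow> real" where r: "bij r"
    using nat_sets_eqpoll_reals by (auto simp: eqpoll_def)
  \<comment> \<open>Real and imaginary part of each value are read as sets of naturals through the
    inverse of \<open>r\<close>. Pairing records the index, and even or odd second components tell
    the two parts apart.\<close>
  define e :: "('i \<Rightarrow> complex) \<Rightarrow> nat set" where
    "e f = {prod_encode (to_nat i, 2 * k) |i k. k \<in> inv_into UNIV r (Re (f i))} \<union>
           {prod_encode (to_nat i, 2 * k + 1) |i k. k \<in> inv_into UNIV r (Im (f i))}" for f
  have eR: "prod_encode (to_nat i, 2 * k) \<in> e f \<longleftrightarrow> k \<in> inv_into UNIV r (Re (f i))" for f i k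
    unfolding e_def by (auto simp: prod_encode_eq) presburger
  have eI: "prod_encode (to_nat i, 2 * k + 1) \<in> e f \<longleftrightarrow> k \<in> inv_into UNIV r (Im (f i))" for f i k
    unfolding e_def by (auto simp: prod_encode_eq) presburger
  have ir: "inv_into UNIV r a = inv_into UNIV r b \<longleftrightarrow> a = b" for a b
    using bij_imp_bij_inv[OF r] by (auto simp: bij_def inj_def)
  have "inj e"
  proof (rule injI, rule ext, rule complex_eqI)
    fix f f' :: "'i \<Rightarrow> complex" and i assume "e f = e f'"
    then have "inv_into UNIV r (Re (f i)) = inv_into UNIV r (Re (f' i))" "inv_into UNIV r (Im (f i)) = inv_into UNIV r (Im (f' i))"
      using eR[of i _ f] eR[of i _ f'] eI[of i _ f] eI[of i _ f'] by blast+
    then show "Re (f i) = Re (f' i)" "Im (f i) = Im (f' i)" by (simp_all add: ir)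
  qed
  moreover have "inj complex_of_real" by (rule inj_of_real)
  ultimately have "inj (h \<circ> (complex_of_real \<circ> (r \<circ> e)))"
    using h r by (intro inj_compose) (auto simp: bij_def)
  then show ?thesis by blast
qed

abbreviation coord :: "(('i \<Rightarrow> complex) \<Rightarrow> 'h) \<Rightarrow> 'h \<Rightarrow> 'i \<Rightarrow> complex" where
  "coord g \<equiv> inv_into UNIV g"

text \<open>Functions supported on \<open>I\<close>, encoded in the type \<open>'h\<close> by the injection \<open>g\<close>. With the
  pointwise \<open>mult\<close> and \<open>one\<close>, the case of a one-point index type is literally \<open>complex_hilbert\<close>.\<close>

definition coord_space :: "(('i \<Rightarrow> complex) \<Rightarrow> 'h) \<Rightarrow> 'i set \<Rightarrow> 'h hilbert" where
  "coord_space g I = \<lparr>carrier = g ` {f. \<forall>i. i \<notin> I \<longrightarrow> f i = 0},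
     mult = (\<lambda>x y. g (\<lambda>i. coord g x i * coord g y i)), one = g (\<lambda>_. 1),
     zero = g (\<lambda>_. 0), add = (\<lambda>x y. g (\<lambda>i. coord g x i + coord g y i)),
     smult = (\<lambda>a x. g (\<lambda>i. a * coord g x i)),
     ip = (\<lambda>x y. \<Sum>i\<in>I. cnj (coord g x i) * coord g y i)\<rparr>"

locale coordinates =
  fixes g :: "('i \<Rightarrow> complex) \<Rightarrow> 'h" and I :: "'i set"
  assumes inj_g: "inj g" and fin_I: "finite I"
begin

abbreviation C where "C \<equiv> coord_space g I"

lemma coord_g [simp]: "coord g (g f) = f"
  using inj_g by simp

lemma carrier_iff: "x \<in> carrier C \<longleftrightarrow> x \<in> range g \<and> (\<forall>i. i \<notin> I \<longrightarrow> coord g x i = 0)"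
  by (auto simp: coord_space_def)

lemma g_in_carrier [simp]: "g f \<in> carrier C \<longleftrightarrow> (\<forall>i. i \<notin> I \<longrightarrow> f i = 0)"
  by (auto simp: carrier_iff)

lemma g_coord [simp]: "x \<in> carrier C \<Longrightarrow> g (coord g x) = x"
  by (auto simp: carrier_iff)

lemma add_C: "x \<oplus>\<^bsub>C\<^esub> y = g (\<lambda>i. coord g x i + coord g y i)"
  and smult_C: "a \<odot>\<^bsub>C\<^esub> x = g (\<lambda>i. a * coord g x i)"
  and zero_C: "\<zero>\<^bsub>C\<^esub> = g (\<lambda>_. 0)"
  and ip_C: "ip C x y = (\<Sum>i\<in>I. cnj (coord g x i) * coord g y i)"
  by (simp_all add: coord_space_def)

lemma ip_self_C: "ip C x x = of_real (\<Sum>i\<in>I. (cmod (coord g x i))\<^sup>2)"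
  by (simp add: ip_C complex_norm_square mult.commute del: of_real_power)

lemma vectorspace_C: "vectorspace class_ring C"
proof (rule vs_criteria)
  show "\<forall>v\<in>carrier C. \<exists>neg_v\<in>carrier C. v \<oplus>\<^bsub>C\<^esub> neg_v = \<zero>\<^bsub>C\<^esub>"
  proof
    fix v assume "v \<in> carrier C"
    then show "\<exists>neg_v\<in>carrier C. v \<oplus>\<^bsub>C\<^esub> neg_v = \<zero>\<^bsub>C\<^esub>"
      by (intro bexI[of _ "g (\<lambda>i. - coord g v i)"]) (auto simp: add_C zero_C carrier_iff)
  qed
qed (auto simp: class_field add_C smult_C zero_C algebra_simps carrier_iff)

sublocale pre_hilbert_space C
proof (rule pre_hilbert_space.intro[OF vectorspace_C], unfold_locales)
  fix x y z c
  show "ip C x (y \<oplus>\<^bsub>C\<^esub> z) = ip C x y + ip C x z"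
    by (simp add: ip_C add_C algebra_simps sum.distrib)
  show "ip C x (c \<odot>\<^bsub>C\<^esub> y) = c * ip C x y"
    by (simp add: ip_C smult_C algebra_simps sum_distrib_left)
  show "ip C y x = cnj (ip C x y)"
    by (simp add: ip_C mult.commute)
  show "0 \<le> Re (ip C x x)"
    by (simp add: ip_self_C sum_nonneg)
  assume x: "x \<in> carrier C" "ip C x x = 0"
  then have "coord g x = (\<lambda>_. 0)"
    using fin_I unfolding ip_self_C of_real_eq_0_iff by (subst (asm) sum_nonneg_eq_0_iff) (auto simp: carrier_iff)
  then show "x = \<zero>\<^bsub>C\<^esub>" using g_coord[OF x(1)] by (simp add: zero_C)
qed

lemma hnorm_C: "hnorm C x = L2_set (\<lambda>i. cmod (coord g x i)) I"
  by (simp add: hnorm_def ip_self_C L2_set_def)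

lemma hdist_C:
  assumes "x \<in> carrier C" "y \<in> carrier C"
  shows "hdist C x y = L2_set (\<lambda>i. cmod (coord g x i - coord g y i)) I"
  using assms by (simp add: hdist_def hnorm_C a_minus_def minus_eq_smult) (simp add: add_C smult_C)

text \<open>A Cauchy sequence is Cauchy in each coordinate. As \<open>I\<close> is finite,
  coordinatewise convergence gives convergence in the norm.\<close>

lemma mcomplete_C: "Metric_space.mcomplete (carrier C) (hdist C)"
proof -
  interpret M: Metric_space "carrier C" "hdist C" by (rule Metric_space_hdist)
  show ?thesis
    unfolding M.mcomplete_def
  proof (intro allI impI)
    fix \<sigma> assume \<sigma>: "M.MCauchy \<sigma>"
    then have \<sigma>c: "\<sigma> n \<in> carrier C" for n by (auto simp: M.MCauchy_def)
    have "\<exists>l. (\<lambda>n. coord g (\<sigma> n) i) \<longlonglongrightarrow> l" if i: "i \<in> I" for i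
    proof -
      have le: "cmod (coord g (\<sigma> m) i - coord g (\<sigma> n) i) \<le> hdist C (\<sigma> m) (\<sigma> n)" for m n
        unfolding hdist_C[OF \<sigma>c \<sigma>c]
        using member_le_L2_set[OF fin_I i, of "\<lambda>i. cmod (coord g (\<sigma> m) i - coord g (\<sigma> n) i)"] by simp
      have "Cauchy (\<lambda>n. coord g (\<sigma> n) i)"
        unfolding Cauchy_def dist_norm
        using \<sigma> le unfolding M.MCauchy_def by (meson le_less_trans)
      then show ?thesis by (simp add: Cauchy_convergent_iff convergent_def)
    qed
    then obtain l where l: "\<And>i. i \<in> I \<Longrightarrow> (\<lambda>n. coord g (\<sigma> n) i) \<longlonglongrightarrow> l i" by metis
    \<comment> \<open>The value \<open>0\<close> outside \<open>I\<close> puts the limit into the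
      carrier.\<close>
    define x where "x = g (\<lambda>i. if i \<in> I then l i else 0)"
    have x: "x \<in> carrier C" by (simp add: x_def)
    have "(\<lambda>n. L2_set (\<lambda>i. cmod (coord g (\<sigma> n) i - coord g x i)) I) \<longlonglongrightarrow> sqrt (\<Sum>i\<in>I. (cmod (l i - coord g x i))\<^sup>2)"
      unfolding L2_set_def by (intro tendsto_intros l)
    then have "(\<lambda>n. hdist C (\<sigma> n) x) \<longlonglongrightarrow> 0"
      by (simp add: hdist_C \<sigma>c x) (simp add: x_def)
    then have "limitin M.mtopology \<sigma> x sequentially"
      unfolding M.limit_metric_sequentially LIMSEQ_def using x \<sigma>c by (auto simp: dist_norm)
    then show "\<exists>x. limitin M.mtopology \<sigma> x sequentially" by blast
  qed
qed

sublocale hilbert_space C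
  by (simp add: hilbert_space_iff pre_hilbert_space_axioms mcomplete_C)

section \<open>Standard basis and dimension of a coordinate space\<close>

definition unit_vec :: "'i \<Rightarrow> 'h" where
  "unit_vec i = g (\<lambda>j. if j = i then 1 else 0)"

lemma unit_vec_closed: "i \<in> I \<Longrightarrow> unit_vec i \<in> carrier C"
  by (auto simp: unit_vec_def)

lemma inj_unit_vec: "inj unit_vec"
proof (rule injI)
  fix i j assume "unit_vec i = unit_vec j"
  then have "coord g (unit_vec i) i = coord g (unit_vec j) i" by simp
  then show "i = j" by (simp add: unit_vec_def split: if_splits)
qed

lemma lincomb_unit_vec:
  assumes "J \<subseteq> I"
  shows "lincomb a (unit_vec ` J) = g (\<lambda>i. if i \<in> J then a (unit_vec i) else 0)"
  using finite_subset[OF assms fin_I] assms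
proof (induction J)
  case empty
  then show ?case by (simp add: lincomb_def zero_C)
next
  case (insert i J)
  have "lincomb a (unit_vec ` J \<union> {unit_vec i}) = a (unit_vec i) \<odot>\<^bsub>C\<^esub> unit_vec i \<oplus>\<^bsub>C\<^esub> lincomb a (unit_vec ` J)"
    using insert unit_vec_closed inj_unit_vec by (intro lincomb_insert) (auto simp: inj_image_mem_iff)
  also have "\<dots> = g (\<lambda>j. if j \<in> insert i J then a (unit_vec j) else 0)"
    using insert by (auto simp: add_C smult_C unit_vec_def intro!: arg_cong[where f = g])
  finally show ?case by simp
qed

lemma span_unit_vec: "span (unit_vec ` I) = carrier C"
proof
  show "span (unit_vec ` I) \<subseteq> carrier C"
    using unit_vec_closed by (intro span_is_subset2) auto
  show "carrier C \<subseteq> span (unit_vec ` I)"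
  proof
    fix x assume x: "x \<in> carrier C"
    \<comment> \<open>Coefficients of \<open>lincomb\<close> are attached to vectors, so the index
      is recovered from the unit vector.\<close>
    let ?a = "\<lambda>v. coord g x (inv_into UNIV unit_vec v)"
    have "(\<lambda>i. if i \<in> I then ?a (unit_vec i) else 0) = coord g x"
      using x inj_unit_vec by (auto simp: carrier_iff)
    then have "lincomb ?a (unit_vec ` I) = x"
      using g_coord[OF x] by (simp add: lincomb_unit_vec)
    moreover have "lincomb ?a (unit_vec ` I) \<in> span (unit_vec ` I)"
      using finite_span[of "unit_vec ` I"] fin_I unit_vec_closed by auto
    ultimately show "x \<in> span (unit_vec ` I)" by simp
  qed
qed

lemma basis_unit_vec: "basis (unit_vec ` I)"
proof -
  have "lin_indpt (unit_vec ` I)"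
  proof (rule finite_lin_indpt2)
    fix a assume "lincomb a (unit_vec ` I) = \<zero>\<^bsub>C\<^esub>"
    then have *: "(\<lambda>i. if i \<in> I then a (unit_vec i) else 0) = (\<lambda>_. 0)"
      using inj_g by (simp add: lincomb_unit_vec zero_C inj_eq)
    show "\<forall>v\<in>unit_vec ` I. a v = \<zero>\<^bsub>class_ring\<^esub>"
    proof
      fix v assume "v \<in> unit_vec ` I"
      then obtain i where "i \<in> I" "v = unit_vec i" by blast
      with fun_cong[OF *, of i] show "a v = \<zero>\<^bsub>class_ring\<^esub>" by simp
    qed
  qed (use fin_I unit_vec_closed in auto)
  then show ?thesis using span_unit_vec unit_vec_closed by (auto simp: basis_def)
qed

lemma fin_dim_C: "fin_dim" and dim_C: "dim = card I"
proof -
  show "fin_dim"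
    unfolding fin_dim_def using fin_I span_unit_vec unit_vec_closed by (intro exI[of _ "unit_vec ` I"]) auto
  have "dim = card (unit_vec ` I)" using fin_I basis_unit_vec by (intro dim_basis) auto
  then show "dim = card I" using inj_unit_vec by (simp add: card_image inj_on_subset)
qed

end

text \<open>The scalars are the coordinate space over a one-point index set and inherit completeness
  from it.\<close>

lemma hilbert_space_complex: "hilbert_space complex_hilbert"
proof -
  define g :: "(unit \<Rightarrow> complex) \<Rightarrow> complex" where "g f = f ()" for f
  have "inj g" by (auto simp: inj_def g_def)
  then interpret coordinates g UNIV by unfold_locales auto
  have "coord g z = (\<lambda>_. z)" for z
    using coord_g[of "\<lambda>_. z"] by (simp add: g_def)
  moreover have "range g = UNIV"
    by (auto simp: g_def image_def intro: exI[of _ "\<lambda>_. _"])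
  ultimately have "C = complex_hilbert"
    by (simp add: coord_space_def complex_hilbert_def g_def UNIV_unit)
  then show ?thesis using hilbert_space_axioms by simp
qed

section \<open>The subproduct system of a word system\<close>

locale coded_word_system = word_system A X for A :: "'i set" and X +
  fixes g :: "('i list \<Rightarrow> complex) \<Rightarrow> 'h"
  assumes inj_g: "inj g" and finite_X: "finite (X n)"
begin

text \<open>As the lengths are fixed, concatenation identifies \<open>X m \<times> X n\<close> with a set of words that
  contains \<open>X (m + n)\<close>. This makes the product a restriction map whose adjoint is the inclusion.\<close>

abbreviation XX where "XX m n \<equiv> (\<lambda>(u, v). u @ v) ` (X m \<times> X n)"

sublocale H: coordinates g "X n" for n
  by unfold_locales (auto simp: inj_g finite_X)

sublocale HH: coordinates g "XX m n" for m n
  by unfold_locales (auto simp: inj_g finite_X)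

definition tens :: "nat \<Rightarrow> nat \<Rightarrow> 'h \<Rightarrow> 'h \<Rightarrow> 'h" where
  "tens m n x y = g (\<lambda>s. coord g x (take m s) * coord g y (drop m s))"

definition restr :: "nat \<Rightarrow> nat \<Rightarrow> 'h \<Rightarrow> 'h" where
  "restr m n x = g (\<lambda>s. if s \<in> X (m + n) then coord g x s else 0)"

definition scalar :: "complex \<Rightarrow> 'h" where
  "scalar a = g (\<lambda>s. if s = [] then a else 0)"

lemma length_X: "u \<in> X n \<Longrightarrow> length u = n"
  using X_subset[of n] by (auto simp: words_def)

lemma subword_X:
  assumes "p @ y @ s \<in> X n"
  shows "y \<in> X (length y)"
proof (rule subword_closed)
  show "p @ y @ s \<in> (\<Union>n. X n)" using assms by blast
  show "y \<in> words A (length y)" using assms X_subset[of n] by (auto simp: words_def)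
  show "sublist y (p @ y @ s)" by (auto simp: sublist_def)
qed

lemma take_X: "s \<in> X n \<Longrightarrow> m \<le> n \<Longrightarrow> take m s \<in> X m"
  using subword_X[of "[]" "take m s" "drop m s" n] length_X[of s n] by (auto simp: min_def split: if_splits)

lemma drop_X: "s \<in> X n \<Longrightarrow> m \<le> n \<Longrightarrow> drop m s \<in> X (n - m)"
  using subword_X[of "take m s" "drop m s" "[]" n] length_X[of s n] by simp

text \<open>Closure under subwords enters here: both pieces of a split word belong to the
  system.\<close>

lemma X_subset_XX: "X (m + n) \<subseteq> XX m n"
proof
  fix s assume "s \<in> X (m + n)"
  then have "take m s \<in> X m" "drop m s \<in> X n"
    using take_X[of s "m + n" m] drop_X[of s "m + n" m] by auto
  then show "s \<in> XX m n" by (intro image_eqI[of _ _ "(take m s, drop m s)"]) auto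
qed

lemma X_0_eq: "X 0 = {[]}"
  unfolding X_0 by (auto simp: words_def)

lemma inj_on_append: "inj_on (\<lambda>(u, v). u @ v) (X m \<times> X n)"
proof (rule inj_onI, clarify)
  fix u v u' v' assume "u \<in> X m" "u' \<in> X m" "u @ v = u' @ v'"
  then show "u = u' \<and> v = v'" using length_X[of u m] length_X[of u' m] by simp
qed

lemma take_drop_XX: "\<lbrakk>take m s \<in> X m; drop m s \<in> X n\<rbrakk> \<Longrightarrow> s \<in> XX m n"
  by (intro image_eqI[of _ _ "(take m s, drop m s)"]) auto

section \<open>Tensor products of coordinate spaces\<close>

lemma tens_closed:
  assumes "x \<in> carrier (H.C m)" "y \<in> carrier (H.C n)"
  shows "tens m n x y \<in> carrier (HH.C m n)"
  using assms take_drop_XX[of m _ n] by (auto simp: tens_def H.carrier_iff)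

lemma tens_unit_vec:
  assumes "u \<in> X m" "v \<in> X n"
  shows "tens m n (H.unit_vec u) (H.unit_vec v) = HH.unit_vec (u @ v)"
proof -
  have "(if take m s = u then 1 else 0) * (if drop m s = v then 1 else 0) =
      (if s = u @ v then 1 else (0 :: complex))" for s
  proof -
    have "s = u @ v \<longleftrightarrow> take m s = u \<and> drop m s = v"
      using length_X[OF assms(1)] by (metis append_eq_conv_conj append_take_drop_id)
    then show ?thesis by simp
  qed
  then show ?thesis
    by (simp add: tens_def H.unit_vec_def HH.unit_vec_def)
qed

text \<open>Unique splitting turns the sum over concatenations into a product of two sums. The
  elementary tensors include all unit vectors, so their span is already the whole space and density
  is immediate.\<close>

lemma tensor_product_coord: "tensor_product (H.C m) (H.C n) (HH.C m n) (tens m n)"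
  unfolding tensor_product_def
proof (intro conjI ballI)
  show "hilbert_space (H.C m)" "hilbert_space (H.C n)" "hilbert_space (HH.C m n)"
    by (rule H.hilbert_space_axioms HH.hilbert_space_axioms)+
  show "linear_map class_ring (H.C n) (HH.C m n) (\<lambda>y. tens m n x y)" if "x \<in> carrier (H.C m)" for x
    unfolding linear_map_iff module_hom_def using that
    by (auto simp: H.vectorspace_C HH.vectorspace_C tens_closed)
       (simp_all add: tens_def H.add_C HH.add_C H.smult_C HH.smult_C algebra_simps)
  show "linear_map class_ring (H.C m) (HH.C m n) (\<lambda>x. tens m n x y)" if "y \<in> carrier (H.C n)" for y
    unfolding linear_map_iff module_hom_def using that
    by (auto simp: H.vectorspace_C HH.vectorspace_C tens_closed)
       (simp_all add: tens_def H.add_C HH.add_C H.smult_C HH.smult_C algebra_simps)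
  show "ip (HH.C m n) (tens m n x y) (tens m n x' y') = ip (H.C m) x x' * ip (H.C n) y y'" for x x' y y'
  proof -
    have "ip (HH.C m n) (tens m n x y) (tens m n x' y') =
        (\<Sum>(u, v)\<in>X m \<times> X n. (cnj (coord g x u) * coord g x' u) * (cnj (coord g y v) * coord g y' v))"
      unfolding HH.ip_C sum.reindex[OF inj_on_append]
      by (rule sum.cong) (auto simp: tens_def length_X)
    also have "\<dots> = ip (H.C m) x x' * ip (H.C n) y y'"
      unfolding H.ip_C sum_product sum.cartesian_product ..
    finally show ?thesis .
  qed
  let ?S = "{tens m n x y |x y. x \<in> carrier (H.C m) \<and> y \<in> carrier (H.C n)}"
  have S: "?S \<subseteq> carrier (HH.C m n)" using tens_closed by blast
  have "HH.unit_vec ` XX m n \<subseteq> ?S"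
  proof
    fix z assume "z \<in> HH.unit_vec ` XX m n"
    then obtain u v where uv: "u \<in> X m" "v \<in> X n" "z = HH.unit_vec (u @ v)" by auto
    show "z \<in> ?S"
      unfolding uv(3) tens_unit_vec[OF uv(1,2), symmetric]
      using H.unit_vec_closed[OF uv(1)] H.unit_vec_closed[OF uv(2)] by blast
  qed
  then have "carrier (HH.C m n) \<subseteq> module.span class_ring (HH.C m n) ?S"
    using HH.span_is_monotone[of "HH.unit_vec ` XX m n" ?S m n] HH.span_unit_vec[of m n] by simp
  then have span: "module.span class_ring (HH.C m n) ?S = carrier (HH.C m n)"
    using HH.span_is_subset2[OF S] by blast
  interpret M: Metric_space "carrier (HH.C m n)" "hdist (HH.C m n)"
    by (rule HH.Metric_space_hdist)
  show "Metric_space.mtopology (carrier (HH.C m n)) (hdist (HH.C m n)) closure_of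
      module.span class_ring (HH.C m n) ?S = carrier (HH.C m n)"
    unfolding span using closure_of_topspace[of M.mtopology] by simp
qed

lemma H_carrier_subset: "carrier (H.C (m + n)) \<subseteq> carrier (HH.C m n)"
  using X_subset_XX[of m n] unfolding subset_iff H.carrier_iff HH.carrier_iff by blast

lemma coisometry_restr: "coisometry (HH.C m n) (H.C (m + n)) (restr m n)"
  unfolding coisometry_def
proof (intro conjI exI[of _ "\<lambda>y. y"] ballI)
  have sub: "X (m + n) \<subseteq> XX m n" by (rule X_subset_XX)
  have lin: "linear_map class_ring (HH.C m n) (H.C (m + n)) (restr m n)"
    unfolding linear_map_iff module_hom_def
    by (auto simp: H.vectorspace_C HH.vectorspace_C restr_def H.add_C HH.add_C H.smult_C HH.smult_C
      intro!: arg_cong[where f = g])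
  have "hnorm (H.C (m + n)) (restr m n x) \<le> 1 * hnorm (HH.C m n) x" for x
    unfolding H.hnorm_C HH.hnorm_C L2_set_def
    using sub HH.fin_I by (auto simp: restr_def intro!: sum_mono2)
  then show "bounded_operator (HH.C m n) (H.C (m + n)) (restr m n)"
    unfolding bounded_operator_def using lin H.hilbert_space_axioms HH.hilbert_space_axioms by blast
  have lin': "linear_map class_ring (H.C (m + n)) (HH.C m n) (\<lambda>y. y)"
    unfolding linear_map_iff module_hom_def using H_carrier_subset
    by (auto simp: H.vectorspace_C HH.vectorspace_C H.add_C HH.add_C H.smult_C HH.smult_C)
  \<comment> \<open>A vector supported on \<open>X (m + n)\<close> only sees those coordinates. This
    gives both the bound for the inclusion and the adjoint relation.\<close>
  have ipJ: "ip (HH.C m n) x y = (\<Sum>s\<in>X (m + n). cnj (coord g x s) * coord g y s)"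
    if "y \<in> carrier (H.C (m + n))" for x y
    unfolding HH.ip_C using sub that HH.fin_I
    by (intro sum.mono_neutral_right) (auto simp: H.carrier_iff)
  have "hnorm (HH.C m n) y \<le> 1 * hnorm (H.C (m + n)) y" if "y \<in> carrier (H.C (m + n))" for y
    using ipJ[OF that, of y] by (simp add: hnorm_def H.ip_C)
  then have "bounded_operator (H.C (m + n)) (HH.C m n) (\<lambda>y. y)"
    unfolding bounded_operator_def using lin' H.hilbert_space_axioms HH.hilbert_space_axioms by blast
  moreover have "ip (HH.C m n) x y = ip (H.C (m + n)) (restr m n x) y"
    if "y \<in> carrier (H.C (m + n))" for x y
    unfolding ipJ[OF that] H.ip_C by (simp add: restr_def)
  ultimately show "is_adjoint_of (HH.C m n) (H.C (m + n)) (restr m n) (\<lambda>y. y)"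
    unfolding is_adjoint_of_def by blast
  show "restr m n y = y" if "y \<in> carrier (H.C (m + n))" for y
  proof -
    have "(\<lambda>s. if s \<in> X (m + n) then coord g y s else 0) = coord g y"
      using that by (auto simp: H.carrier_iff)
    then show ?thesis using H.g_coord[OF that] by (simp add: restr_def)
  qed
qed

lemma scalar_closed: "scalar a \<in> carrier (H.C 0)"
  unfolding scalar_def H.g_in_carrier by (simp add: X_0_eq)

lemma unitary_scalar: "unitary_operator complex_hilbert (H.C 0) scalar"
  unfolding unitary_operator_def
proof (intro conjI ballI)
  show "hilbert_space complex_hilbert" by (rule hilbert_space_complex)
  show "hilbert_space (H.C 0)" by (rule H.hilbert_space_axioms)
  have "vectorspace class_ring complex_hilbert"
    using hilbert_space_complex by (simp add: hilbert_space_def)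
  then show "linear_map class_ring complex_hilbert (H.C 0) scalar"
    unfolding linear_map_iff module_hom_def
    by (auto simp: H.vectorspace_C scalar_closed complex_hilbert_def)
       (auto simp: scalar_def H.add_C H.smult_C intro!: arg_cong[where f = g])
  show "ip (H.C 0) (scalar x) (scalar y) = ip complex_hilbert x y" for x y
    unfolding H.ip_C by (simp add: X_0_eq scalar_def complex_hilbert_def)
  show "bij_betw scalar (carrier complex_hilbert) (carrier (H.C 0))"
  proof (rule bij_betw_byWitness[where f' = "\<lambda>x. coord g x []"])
    show "\<forall>a\<in>carrier complex_hilbert. coord g (scalar a) [] = a" by (simp add: scalar_def)
    show "\<forall>x\<in>carrier (H.C 0). scalar (coord g x []) = x"
    proof
      fix x assume x: "x \<in> carrier (H.C 0)"
      then have "(\<lambda>s. if s = [] then coord g x [] else 0) = coord g x"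
        unfolding H.carrier_iff by (auto simp: X_0_eq)
      then show "scalar (coord g x []) = x" using H.g_coord[OF x] by (simp add: scalar_def)
    qed
  qed (auto simp: complex_hilbert_def scalar_closed)
qed

lemma subproduct_system_coord:
  "subproduct_system (\<lambda>n. H.C n) (\<lambda>m n. HH.C m n) tens restr scalar"
proof (rule subproduct_system.intro)
  show "hilbert_space (H.C n)" for n by (rule H.hilbert_space_axioms)
  show "unitary_operator complex_hilbert (H.C 0) scalar" by (rule unitary_scalar)
  show "tensor_product (H.C m) (H.C n) (HH.C m n) (tens m n)" for m n by (rule tensor_product_coord)
  show "coisometry (HH.C m n) (H.C (m + n)) (restr m n)" for m n by (rule coisometry_restr)
  show "restr (m + n) k (tens (m + n) k (restr m n (tens m n x y)) z) =
      restr m (n + k) (tens m (n + k) x (restr n k (tens n k y z)))" for m n k x y z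
  proof -
    let ?l = "\<lambda>s. (if take (m + n) s \<in> X (m + n)
      then coord g x (take m (take (m + n) s)) * coord g y (drop m (take (m + n) s)) else 0) *
      coord g z (drop (m + n) s)"
    let ?r = "\<lambda>s. coord g x (take m s) * (if drop m s \<in> X (n + k)
      then coord g y (take n (drop m s)) * coord g z (drop n (drop m s)) else 0)"
    \<comment> \<open>Prefixes and suffixes of a word of the system are again in it, so both inner
      case distinctions succeed and each side is the product of the same three coordinates.\<close>
    have "?l s = ?r s" if s: "s \<in> X (m + n + k)" for s
    proof -
      have "take (m + n) s \<in> X (m + n)" "drop m s \<in> X (n + k)"
        using take_X[OF s, of "m + n"] drop_X[OF s, of m] by (auto simp: add.assoc)
      then show ?thesis by (simp add: drop_take add.commute[of n m])
    qed
    then have "(\<lambda>s. if s \<in> X (m + n + k) then ?l s else 0) = (\<lambda>s. if s \<in> X (m + (n + k)) then ?r s else 0)"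
      by (intro ext if_cong) (simp_all only: add.assoc)
    then show ?thesis
      by (simp only: restr_def tens_def H.coord_g)
  qed
  show "restr 0 n (tens 0 n (scalar c) x) = c \<odot>\<^bsub>H.C n\<^esub> x" if "x \<in> carrier (H.C n)" for n c x
    using that by (auto simp: restr_def tens_def scalar_def H.smult_C H.carrier_iff intro!: arg_cong[where f = g])
  \<comment> \<open>Words in \<open>X n\<close> have length \<open>n\<close>, so
    \<open>drop n s\<close> is empty and the scalar contributes \<open>c\<close>.\<close>
  show "restr n 0 (tens n 0 x (scalar c)) = c \<odot>\<^bsub>H.C n\<^esub> x" if "x \<in> carrier (H.C n)" for n c x
    using that length_X[of _ n]
    by (auto simp: restr_def tens_def scalar_def H.smult_C H.carrier_iff intro!: arg_cong[where f = g] ext)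
qed

end

text \<open>Alphabets and spaces live in fixed types, which must have room for the witnesses:
  countably many letters in \<open>'a\<close>, and complex functions on words in \<open>'h\<close>.
  Finiteness is stated along with \<open>dim\<close> and \<open>card\<close>, whose values are
  meaningful as counts only then.\<close>

theorem theorem3p15:
  fixes d :: "nat \<Rightarrow> nat"
  assumes "infinite (UNIV :: 'a set)"
    and "(UNIV :: complex set) \<lesssim> (UNIV :: 'h set)"
  shows "(\<exists>(H :: nat \<Rightarrow> 'h hilbert) HH tens w \<iota>. subproduct_system H HH tens w \<iota> \<and>
            (\<forall>n. vectorspace.fin_dim class_ring (H n) \<and> vectorspace.dim class_ring (H n) = d n)) \<longleftrightarrow>
         (\<exists>(A :: 'a set) X. word_system A X \<and> (\<forall>n. finite (X n) \<and> card (X n) = d n))"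
proof
  assume "\<exists>(H :: nat \<Rightarrow> 'h hilbert) HH tens w \<iota>. subproduct_system H HH tens w \<iota> \<and>
            (\<forall>n. vectorspace.fin_dim class_ring (H n) \<and> vectorspace.dim class_ring (H n) = d n)"
  then obtain H :: "nat \<Rightarrow> 'h hilbert" and HH tens w \<iota> where
    H: "subproduct_system H HH tens w \<iota>" and
    d: "\<And>n. vectorspace.fin_dim class_ring (H n)" "\<And>n. vectorspace.dim class_ring (H n) = d n"
    by blast
  obtain B :: "nat set" and Y where Y: "word_system B Y" "\<And>n. finite (Y n) \<and> card (Y n) = d n"
    using subproduct_system.ex_word_system[OF H d(1)] d(2) by auto
  obtain f :: "nat \<Rightarrow> 'a" where "inj f"
    using infinite_countable_subset[OF assms(1)] by blast
  then have f: "inj_on f B" by (rule inj_on_subset) simp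
  have "word_system (f ` B) (\<lambda>n. map f ` Y n)" by (rule word_system_map[OF Y(1) f])
  moreover have "finite (map f ` Y n) \<and> card (map f ` Y n) = d n" for n
    using Y(2) card_map_word_system[OF Y(1) f] by simp
  ultimately show "\<exists>(A :: 'a set) X. word_system A X \<and> (\<forall>n. finite (X n) \<and> card (X n) = d n)"
    by blast
next
  assume "\<exists>(A :: 'a set) X. word_system A X \<and> (\<forall>n. finite (X n) \<and> card (X n) = d n)"
  then obtain A :: "'a set" and X where X: "word_system A X" "\<And>n. finite (X n)" "\<And>n. card (X n) = d n"
    by blast
  define B where "B = {a. [a] \<in> X 1}"
  have B: "word_system B X" unfolding B_def by (rule word_system_letters[OF X(1)])
  have "finite B"
    unfolding B_def using finite_vimageI[OF X(2)[of 1], of "\<lambda>a. [a]"] by (simp add: vimage_def inj_def)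
  \<comment> \<open>Renaming the finitely many letters by naturals makes the index type
    \<open>nat list\<close> countable, as the coding \<open>g\<close> demands.\<close>
  then obtain f :: "'a \<Rightarrow> nat" where f: "inj_on f B"
    using finite_imp_inj_to_nat_seg by blast
  obtain g :: "(nat list \<Rightarrow> complex) \<Rightarrow> 'h" where g: "inj g"
    using ex_inj_complex_functions[OF assms(2)] by blast
  interpret coded_word_system "f ` B" "\<lambda>n. map f ` X n" g
    by (rule coded_word_system.intro[OF word_system_map[OF B f]]) (unfold_locales, auto simp: g X(2))
  have "vectorspace.dim class_ring (H.C n) = d n" for n
    using H.dim_C card_map_word_system[OF B f] X(3) by simp
  then show "\<exists>(H :: nat \<Rightarrow> 'h hilbert) HH tens w \<iota>. subproduct_system H HH tens w \<iota> \<and>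
            (\<forall>n. vectorspace.fin_dim class_ring (H n) \<and> vectorspace.dim class_ring (H n) = d n)"
    using subproduct_system_coord H.fin_dim_C by blast
qed

end
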